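(* For every integer $n\ge 2$ there are infinitely many faithful $n$-color fair games, i.e. infinitely many tuples $(a_1,\dots,a_n)$ of positive integers satisfying $\binom{\sum_{i=1}^n a_i}{2}=2\sum_{i=1}^n\binom{a_i}{2}$.
   Context: An $n$-color fair game is a tuple of non-negative integers $(x_1,\dots,x_n)$ satisfying $\binom{\sum_{i} x_i}{2}=2\sum_{i}\binom{x_i}{2}$, equivalently $\left(\sum_i x_i\right)^2-\sum_i x_i-4\sum_{1\le i<j\le n}x_ix_j=0$. A game is faithful if all its coordinates are positive. *)

theory Defs
  imports Complex_Main
begin

(* An n-tuple of non-negative integers is a nat list of length n. *)
definition fair_game :: "nat \<Rightarrow> nat list \<Rightarrow> bool" where
  "fair_game n xs \<longleftrightarrow>
     length xs = n \<and> (sum_list xs choose 2) = 2 * (\<Sum>x\<leftarrow>xs. x choose 2)"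

definition faithful :: "nat list \<Rightarrow> bool" where
  "faithful xs \<longleftrightarrow> (\<forall>x\<in>set xs. 0 < x)"

end

theory Submission
  imports Defs
begin

text \<open>In terms of the sum \<open>S\<close> and the sum of squares \<open>Q\<close>, fairness says \<open>S\<^sup>2 + S = 2 Q\<close>.
  Adding a coordinate \<open>x\<close> to a fair game keeps it fair if \<open>2 S x + x = x\<^sup>2\<close>, so \<open>x = 2 S + 1\<close>
  always works. For two colors, fairness is \<open>(a - b)\<^sup>2 = a + b\<close>, which
  consecutive triangular numbers satisfy.\<close>

lemma double_choose_two: "2 * (m choose 2) + m = m\<^sup>2" for m :: nat
  by (induction m) (simp_all add: choose_two numeral_2_eq_2 algebra_simps)

text \<open>Doubling the binomial equation gives \<open>S\<^sup>2 - S = 2 * (Q - S)\<close>; moving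
  \<open>S\<close> across avoids truncated subtraction on naturals.\<close>

lemma fair_game_iff:
  "fair_game n xs \<longleftrightarrow>
     length xs = n \<and> (sum_list xs)\<^sup>2 + sum_list xs = 2 * (\<Sum>x\<leftarrow>xs. x\<^sup>2)"
proof -
  have "2 * (\<Sum>x\<leftarrow>xs. x choose 2) + sum_list xs = (\<Sum>x\<leftarrow>xs. x\<^sup>2)"
  proof (induction xs)
    case (Cons x xs)
    then show ?case
      using double_choose_two[of x] by simp
  qed simp
  then show ?thesis
    using double_choose_two[of "sum_list xs"] unfolding fair_game_def by linarith
qed

lemma fair_game_Cons:
  assumes "fair_game n xs"
  shows "fair_game (Suc n) ((2 * sum_list xs + 1) # xs)"
  using assms unfolding fair_game_iff by (simp add: power2_eq_square algebra_simps)

lemma fair_game_triangular: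
  assumes "2 * a = k * (k + 1)"
  shows "fair_game 2 [a, a + (k + 1)]"
proof -
  have "a + (a + (k + 1)) = (k + 1)\<^sup>2"
    using assms by (simp add: power2_eq_square algebra_simps)
  then show ?thesis
    unfolding fair_game_iff by (simp add: power2_eq_square algebra_simps)
qed

theorem theorem3p1:
  fixes n :: nat
  assumes "n \<ge> 2"
  shows "infinite {xs. fair_game n xs \<and> faithful xs}"
  using assms
proof (induction n rule: nat_induct_at_least)
  case base
  define f where "f k = [k * (k + 1) div 2, k * (k + 1) div 2 + (k + 1)]" for k :: nat
  \<comment> \<open>The two entries differ by \<open>k + 1\<close>, which recovers \<open>k\<close>.
    The index starts at 1 because \<open>f 0 = [0, 1]\<close> is not faithful.\<close>
  have "inj_on f {1..}"
    by (rule inj_onI) (simp add: f_def)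
  then have "infinite (f ` {1..})"
    using infinite_Ici finite_imageD by blast
  moreover have "f ` {1..} \<subseteq> {xs. fair_game 2 xs \<and> faithful xs}"
  proof clarify
    fix k :: nat
    assume "1 \<le> k"
    then have "2 * 1 \<le> k * (k + 1)"
      by (metis add.commute mult_le_mono nat_1_add_1 add_le_mono le_refl mult.commute)
    then have "faithful (f k)"
      unfolding faithful_def f_def by auto
    moreover have "fair_game 2 (f k)"
      \<comment> \<open>The halving is exact, as \<open>k * (k + 1)\<close> is even.\<close>
      unfolding f_def by (rule fair_game_triangular) simp
    ultimately show "fair_game 2 (f k) \<and> faithful (f k)"
      by simp
  qed
  ultimately show ?case
    using infinite_super by blast
next
  case (Suc n)
  define g where "g xs = (2 * sum_list xs + 1) # xs" for xs :: "nat list"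
  \<comment> \<open>The tail of \<open>g xs\<close> is \<open>xs\<close>, so distinct games have
    distinct extensions.\<close>
  have "inj_on g {xs. fair_game n xs \<and> faithful xs}"
    by (rule inj_onI) (simp add: g_def)
  then have "infinite (g ` {xs. fair_game n xs \<and> faithful xs})"
    using Suc.IH finite_imageD by blast
  moreover have "g ` {xs. fair_game n xs \<and> faithful xs} \<subseteq> {xs. fair_game (Suc n) xs \<and> faithful xs}"
    using fair_game_Cons by (auto simp: g_def faithful_def)
  ultimately show ?case
    using infinite_super by blast
qed

end
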